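(* Let $\alpha=(\alpha_n)_{n\ge1}$ be a bounded sequence of non-zero complex numbers, and let $\omega_j=\alpha_1\alpha_2\cdots\alpha_j$ for $j\ge1$. Suppose that $(|\omega_j|^{-1})_{j\geq 1}\notin\ell^2$. Then the bounded operator $T=I\oplus S_\alpha$ on $H^2=\mathbb{C}e_0\oplus H_0^2$, i.e. $$T(\gamma e_0\oplus x)=\gamma e_0\oplus S_\alpha x\qquad(\gamma\in\mathbb{C},\ x\in H_0^2),$$ is cyclic.
   Context: $H^2$ is the Hardy space of the unit disc: holomorphic $f(z)=\sum_{k\ge0}a_kz^k$ on the disc with $\sum_{k\geq 0}|a_k|^2<\infty$, with orthonormal basis $e_n(z)=z^n$, $n\ge0$. $H_0^2=\overline{\operatorname{Span}\{e_1,e_2,\dots\}}$. $S_\alpha$ is the weighted forward shift on $H_0^2$ defined by $S_\alpha e_n=\alpha_ne_{n+1}$, $n\ge1$. A bounded operator $T$ on a Hilbert space $\mathcal{H}$ is cyclic if there is $x\in\mathcal{H}$ such that the linear span of $\{T^nx:n=0,1,2,\dots\}$ is dense in $\mathcal{H}$. *)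

theory Defs
  imports "HOL-Complex_Analysis.Complex_Analysis"
begin

section \<open>Complex Hilbert spaces and cyclic operators\<close>

text \<open>
  The sesquilinear form is linear in its first argument; its real part is the real inner product
  of the underlying real inner product space, so that both give the same norm.
\<close>

class complex_inner = real_inner +
  fixes scaleC :: "complex \<Rightarrow> 'a \<Rightarrow> 'a"  (infixr \<open>*\<^sub>C\<close> 75)
    and cinner :: "'a \<Rightarrow> 'a \<Rightarrow> complex"
  assumes scaleC_add_right: "c *\<^sub>C (x + y) = c *\<^sub>C x + c *\<^sub>C y"
    and scaleC_add_left: "(c + d) *\<^sub>C x = c *\<^sub>C x + d *\<^sub>C x"
    and scaleC_scaleC: "c *\<^sub>C d *\<^sub>C x = (c * d) *\<^sub>C x"
    and scaleC_one: "1 *\<^sub>C x = x"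
    and scaleR_scaleC: "r *\<^sub>R x = complex_of_real r *\<^sub>C x"
    and cinner_commute: "cinner x y = cnj (cinner y x)"
    and cinner_add_left: "cinner (x + y) z = cinner x z + cinner y z"
    and cinner_scaleC_left: "cinner (c *\<^sub>C x) y = c * cinner x y"
    and inner_eq_Re_cinner: "inner x y = Re (cinner x y)"

class complex_hilbert_space = complex_inner + complete_space

global_interpretation complex_vector: vector_space "scaleC :: complex \<Rightarrow> 'a \<Rightarrow> 'a::complex_inner"
  defines cspan = complex_vector.span
  by unfold_locales (simp_all add: scaleC_add_right scaleC_add_left scaleC_scaleC scaleC_one)

definition bounded_clinear :: "('a::complex_inner \<Rightarrow> 'b::complex_inner) \<Rightarrow> bool" where
  "bounded_clinear T \<longleftrightarrow> bounded_linear T \<and> (\<forall>c x. T (c *\<^sub>C x) = c *\<^sub>C T x)"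

definition cyclic_operator :: "('a::complex_hilbert_space \<Rightarrow> 'a) \<Rightarrow> bool" where
  "cyclic_operator T \<longleftrightarrow>
     bounded_clinear T \<and> (\<exists>x. closure (cspan (range (\<lambda>n. (T ^^ n) x))) = UNIV)"


section \<open>The Hardy space of the unit disc\<close>

definition square_summable :: "(nat \<Rightarrow> complex) \<Rightarrow> bool" where
  "square_summable a \<longleftrightarrow> summable (\<lambda>n. (cmod (a n))\<^sup>2)"

definition taylor_coeff :: "(complex \<Rightarrow> complex) \<Rightarrow> nat \<Rightarrow> complex" where
  "taylor_coeff f n = (deriv ^^ n) f 0 / fact n"

lemma square_summable_add:
  assumes "square_summable a" "square_summable b"
  shows "square_summable (\<lambda>n. a n + b n)"
  unfolding square_summable_def
proof (rule summable_comparison_test')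
  show "summable (\<lambda>n. 2 * (cmod (a n))\<^sup>2 + 2 * (cmod (b n))\<^sup>2)"
    using assms unfolding square_summable_def by (intro summable_add summable_mult)
next
  fix n :: nat
  have "(cmod (a n + b n))\<^sup>2 \<le> (cmod (a n) + cmod (b n))\<^sup>2"
    by (intro power_mono norm_triangle_ineq) auto
  also have "\<dots> \<le> 2 * (cmod (a n))\<^sup>2 + 2 * (cmod (b n))\<^sup>2"
    using sum_squares_bound[of "cmod (a n)" "cmod (b n)"] by (simp add: power2_sum)
  finally show "norm ((cmod (a n + b n))\<^sup>2) \<le> 2 * (cmod (a n))\<^sup>2 + 2 * (cmod (b n))\<^sup>2"
    by simp
qed

lemma square_summable_mult:
  assumes "square_summable a" "\<And>n. cmod (m n) \<le> B"
  shows "square_summable (\<lambda>n. m n * a n)"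
  unfolding square_summable_def
proof (rule summable_comparison_test')
  show "summable (\<lambda>n. B\<^sup>2 * (cmod (a n))\<^sup>2)"
    using assms unfolding square_summable_def by (intro summable_mult)
  show "norm ((cmod (m n * a n))\<^sup>2) \<le> B\<^sup>2 * (cmod (a n))\<^sup>2" for n
    using assms(2)[of n] by (simp add: norm_mult power_mult_distrib mult_right_mono power_mono)
qed

lemma square_summable_scale: "square_summable a \<Longrightarrow> square_summable (\<lambda>n. c * a n)"
  by (rule square_summable_mult[where B = "cmod c"]) auto

lemma square_summable_summable_mult_cnj:
  assumes "square_summable a" "square_summable b"
  shows "summable (\<lambda>n. a n * cnj (b n))"
proof (rule summable_comparison_test')
  show "summable (\<lambda>n. (cmod (a n))\<^sup>2 + (cmod (b n))\<^sup>2)"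
    using assms unfolding square_summable_def by (intro summable_add)
  show "norm (a n * cnj (b n)) \<le> (cmod (a n))\<^sup>2 + (cmod (b n))\<^sup>2" for n
  proof -
    have "2 * (cmod (a n) * cmod (b n)) \<le> (cmod (a n))\<^sup>2 + (cmod (b n))\<^sup>2"
      using sum_squares_bound[of "cmod (a n)" "cmod (b n)"] by simp
    moreover have "0 \<le> cmod (a n) * cmod (b n)" by simp
    ultimately show ?thesis unfolding norm_mult complex_mod_cnj by linarith
  qed
qed

lemma taylor_coeff_unique:
  assumes "\<And>z. z \<in> ball 0 1 \<Longrightarrow> (\<lambda>n. a n * z ^ n) sums f z"
  shows "taylor_coeff f n = a n"
proof -
  have "fps_conv_radius (Abs_fps a) \<ge> 1"
    unfolding fps_conv_radius_def
  proof (rule conv_radius_geI_ex)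
    fix r :: real assume "0 < r" "ereal r < 1"
    then show "\<exists>z. norm z = r \<and> summable (\<lambda>n. fps_nth (Abs_fps a) n * z ^ n)"
      using assms[of "of_real r"] by (intro exI[of _ "of_real r"]) (auto simp: sums_iff)
  qed
  then have "fps_conv_radius (Abs_fps a) > 0"
    by (rule less_le_trans[rotated]) simp
  moreover have "eventually (\<lambda>z. eval_fps (Abs_fps a) z = f z) (nhds 0)"
    unfolding eventually_nhds
    by (rule exI[of _ "ball 0 1"]) (use assms in \<open>auto simp: eval_fps_def sums_iff\<close>)
  ultimately have "f has_fps_expansion Abs_fps a"
    by (simp add: has_fps_expansion_def)
  from fps_nth_fps_expansion[OF this, of n] show ?thesis
    by (simp add: taylor_coeff_def)
qed

lemma taylor_coeff_sums:
  assumes "f holomorphic_on ball 0 1" "z \<in> ball 0 1"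
  shows "(\<lambda>n. taylor_coeff f n * z ^ n) sums f z"
  using holomorphic_power_series[OF assms] by (simp add: taylor_coeff_def)

text \<open>
  Functions on the disc are represented by functions on the plane that vanish off the disc, so
  that equality in the type is equality on the disc.
\<close>

typedef hardy =
  "{f :: complex \<Rightarrow> complex. f holomorphic_on ball 0 1 \<and> (\<forall>z. z \<notin> ball 0 1 \<longrightarrow> f z = 0) \<and>
      square_summable (taylor_coeff f)}"
  morphisms hardy_fun Abs_hardy
proof (rule exI[of _ "\<lambda>_. 0"])
  have "taylor_coeff (\<lambda>_. 0) = (\<lambda>_. 0)"
    by (rule ext, rule taylor_coeff_unique) simp
  then show "(\<lambda>_. 0) \<in> {f. f holomorphic_on ball 0 1 \<and> (\<forall>z. z \<notin> ball 0 1 \<longrightarrow> f z = 0) \<and>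
      square_summable (taylor_coeff f)}"
    by (simp add: square_summable_def)
qed

setup_lifting type_definition_hardy

definition hardy_coeff :: "hardy \<Rightarrow> nat \<Rightarrow> complex" where
  "hardy_coeff f = taylor_coeff (hardy_fun f)"

lemma square_summable_coeff: "square_summable (hardy_coeff f)"
  using hardy_fun[of f] by (simp add: hardy_coeff_def)

lemma hardy_coeff_sums: "z \<in> ball 0 1 \<Longrightarrow> (\<lambda>n. hardy_coeff f n * z ^ n) sums hardy_fun f z"
  using hardy_fun[of f] by (simp add: hardy_coeff_def taylor_coeff_sums)

lemma hardy_fun_outside: "z \<notin> ball 0 1 \<Longrightarrow> hardy_fun f z = 0"
  using hardy_fun[of f] by simp

lemma hardy_eqI:
  assumes "\<And>n. hardy_coeff f n = hardy_coeff g n"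
  shows "f = g"
proof -
  have "hardy_fun f z = hardy_fun g z" for z
  proof (cases "z \<in> ball 0 1")
    case True
    with hardy_coeff_sums[of z f] hardy_coeff_sums[of z g] assms show ?thesis
      by (simp add: sums_unique2)
  qed (simp add: hardy_fun_outside)
  then show ?thesis by (auto simp: hardy_fun_inject[symmetric])
qed

definition hardy_of_coeffs :: "(nat \<Rightarrow> complex) \<Rightarrow> hardy" where
  "hardy_of_coeffs a = Abs_hardy (\<lambda>z. if z \<in> ball 0 1 then \<Sum>n. a n * z ^ n else 0)"

lemma hardy_power_series_closed:
  assumes sq: "square_summable a" and s: "\<And>z. z \<in> ball 0 1 \<Longrightarrow> (\<lambda>n. a n * z ^ n) sums f z"
    and o: "\<And>z. z \<notin> ball 0 1 \<Longrightarrow> f z = 0"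
  shows "f holomorphic_on ball 0 1 \<and> (\<forall>z. z \<notin> ball 0 1 \<longrightarrow> f z = 0) \<and>
      square_summable (taylor_coeff f)"
proof (intro conjI allI impI)
  show "f holomorphic_on ball 0 1"
    by (rule power_series_holomorphic[where a = a]) (use s in simp)
  have "taylor_coeff f = a"
    using taylor_coeff_unique[OF s] by blast
  then show "square_summable (taylor_coeff f)" using sq by simp
qed (use o in auto)

lemma hardy_coeff_of_coeffs:
  assumes "square_summable a"
  shows "hardy_coeff (hardy_of_coeffs a) = a"
proof -
  define f where "f = (\<lambda>z. if z \<in> ball 0 1 then \<Sum>n. a n * z ^ n else 0)"
  have s: "(\<lambda>n. a n * z ^ n) sums f z" if z: "z \<in> ball 0 1" for z
  proof -
    have "(\<lambda>n. (cmod (a n))\<^sup>2) \<longlonglongrightarrow> 0"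
      using assms unfolding square_summable_def by (rule summable_LIMSEQ_zero)
    then have "Bseq (\<lambda>n. (cmod (a n))\<^sup>2)"
      by (rule convergent_imp_Bseq[OF convergentI])
    then obtain K where K: "\<And>n. (cmod (a n))\<^sup>2 \<le> K"
      by (auto simp: Bseq_def)
    have bnd: "cmod (a n) \<le> sqrt K" for n
      using K[of n] by (simp add: real_le_rsqrt)
    have "summable (\<lambda>n. a n * z ^ n)"
    proof (rule summable_comparison_test')
      show "summable (\<lambda>n. sqrt K * (cmod z) ^ n)"
        using z by (intro summable_mult summable_geometric) simp
      show "norm (a n * z ^ n) \<le> sqrt K * (cmod z) ^ n" for n
        using bnd[of n] by (simp add: norm_mult norm_power mult_right_mono)
    qed
    then show ?thesis using z by (simp add: f_def sums_iff)
  qed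
  have "f \<in> {f. f holomorphic_on ball 0 1 \<and> (\<forall>z. z \<notin> ball 0 1 \<longrightarrow> f z = 0) \<and>
      square_summable (taylor_coeff f)}"
    using hardy_power_series_closed[OF assms s] by (simp add: f_def)
  then have "hardy_fun (hardy_of_coeffs a) = f"
    unfolding hardy_of_coeffs_def f_def[symmetric] by (rule Abs_hardy_inverse)
  then show ?thesis
    using taylor_coeff_unique[OF s] by (auto simp: hardy_coeff_def)
qed

instantiation hardy :: complex_inner
begin

lift_definition zero_hardy :: hardy is "\<lambda>_. 0"
  by (rule hardy_power_series_closed[of "\<lambda>_. 0"]) (auto simp: square_summable_def)

lift_definition plus_hardy :: "hardy \<Rightarrow> hardy \<Rightarrow> hardy" is "\<lambda>f g z. f z + g z"
  subgoal for f g
    by (rule hardy_power_series_closed[of "\<lambda>n. taylor_coeff f n + taylor_coeff g n"])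
      (auto intro: square_summable_add simp: distrib_right intro!: sums_add taylor_coeff_sums)
  done

lift_definition scaleC_hardy :: "complex \<Rightarrow> hardy \<Rightarrow> hardy" is "\<lambda>c f z. c * f z"
  subgoal for c f
    by (rule hardy_power_series_closed[of "\<lambda>n. c * taylor_coeff f n"])
      (auto intro: square_summable_scale simp: mult.assoc intro!: sums_mult taylor_coeff_sums)
  done

definition uminus_hardy :: "hardy \<Rightarrow> hardy" where "uminus_hardy f = (-1) *\<^sub>C f"

definition minus_hardy :: "hardy \<Rightarrow> hardy \<Rightarrow> hardy" where "minus_hardy f g = f + - g"

definition scaleR_hardy :: "real \<Rightarrow> hardy \<Rightarrow> hardy" where
  "scaleR_hardy r f = complex_of_real r *\<^sub>C f"

definition cinner_hardy :: "hardy \<Rightarrow> hardy \<Rightarrow> complex" where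
  "cinner_hardy f g = (\<Sum>n. hardy_coeff f n * cnj (hardy_coeff g n))"

definition inner_hardy :: "hardy \<Rightarrow> hardy \<Rightarrow> real" where
  "inner_hardy f g = Re (cinner f g)"

definition norm_hardy :: "hardy \<Rightarrow> real" where
  "norm_hardy f = sqrt (inner f f)"

definition sgn_hardy :: "hardy \<Rightarrow> hardy" where
  "sgn_hardy f = inverse (norm f) *\<^sub>R f"

definition dist_hardy :: "hardy \<Rightarrow> hardy \<Rightarrow> real" where
  "dist_hardy f g = norm (f - g)"

definition uniformity_hardy :: "(hardy \<times> hardy) filter" where
  "uniformity_hardy = (INF e\<in>{0 <..}. principal {(x, y). dist x y < e})"

definition open_hardy :: "hardy set \<Rightarrow> bool" where
  "open_hardy U \<longleftrightarrow> (\<forall>x\<in>U. \<forall>\<^sub>F (x', y) in uniformity. x' = x \<longrightarrow> y \<in> U)"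

lemma hardy_fun_zero: "hardy_fun 0 z = 0"
  by transfer simp

lemma hardy_fun_add: "hardy_fun (f + g) z = hardy_fun f z + hardy_fun g z"
  by transfer simp

lemma hardy_fun_scaleC: "hardy_fun (c *\<^sub>C f) z = c * hardy_fun f z"
  by transfer simp

lemma hardy_coeff_zero [simp]: "hardy_coeff 0 n = 0"
  unfolding hardy_coeff_def by (rule taylor_coeff_unique) (simp add: hardy_fun_zero)

lemma hardy_coeff_add [simp]: "hardy_coeff (f + g) n = hardy_coeff f n + hardy_coeff g n"
  unfolding hardy_coeff_def[of "f + g"]
  by (rule taylor_coeff_unique)
    (simp only: hardy_fun_add distrib_right, intro sums_add hardy_coeff_sums)

lemma hardy_coeff_scaleC [simp]: "hardy_coeff (c *\<^sub>C f) n = c * hardy_coeff f n"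
  unfolding hardy_coeff_def[of "c *\<^sub>C f"]
  by (rule taylor_coeff_unique)
    (simp only: hardy_fun_scaleC mult.assoc, intro sums_mult hardy_coeff_sums)

lemma hardy_coeff_uminus [simp]: "hardy_coeff (- f) n = - hardy_coeff f n"
  by (simp add: uminus_hardy_def)

lemma hardy_coeff_diff [simp]: "hardy_coeff (f - g) n = hardy_coeff f n - hardy_coeff g n"
  by (simp add: minus_hardy_def)

lemma hardy_coeff_scaleR [simp]: "hardy_coeff (r *\<^sub>R f) n = r * hardy_coeff f n"
  by (simp add: scaleR_hardy_def)

lemma cinner_hardy_sums: "(\<lambda>n. hardy_coeff f n * cnj (hardy_coeff g n)) sums cinner f g"
  unfolding cinner_hardy_def
  by (intro summable_sums square_summable_summable_mult_cnj square_summable_coeff)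

lemma inner_hardy_sums: "(\<lambda>n. (cmod (hardy_coeff f n))\<^sup>2) sums inner f f"
proof -
  have "(\<lambda>n. Re (hardy_coeff f n * cnj (hardy_coeff f n))) sums inner f f"
    unfolding inner_hardy_def using cinner_hardy_sums by (rule sums_Re)
  then show ?thesis by (simp only: complex_norm_square[symmetric] Re_complex_of_real)
qed

instance
proof
  fix f g h :: hardy and r s :: real and c d :: complex
  show "f + g + h = f + (g + h)" "f + g = g + f" "0 + f = f" "- f + f = 0" "f - g = f + - g"
    "r *\<^sub>R (f + g) = r *\<^sub>R f + r *\<^sub>R g" "(r + s) *\<^sub>R f = r *\<^sub>R f + s *\<^sub>R f"
    "r *\<^sub>R s *\<^sub>R f = (r * s) *\<^sub>R f" "1 *\<^sub>R f = f"
    "c *\<^sub>C (f + g) = c *\<^sub>C f + c *\<^sub>C g" "(c + d) *\<^sub>C f = c *\<^sub>C f + d *\<^sub>C f"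
    "c *\<^sub>C d *\<^sub>C f = (c * d) *\<^sub>C f" "1 *\<^sub>C f = f" "r *\<^sub>R f = complex_of_real r *\<^sub>C f"
    by (rule hardy_eqI; simp add: algebra_simps)+
  show comm: "cinner f g = cnj (cinner g f)" for f g :: hardy
    using sums_unique2[OF cinner_hardy_sums[of f g]] cinner_hardy_sums[of g f, THEN sums_cnj[THEN iffD2]]
    by (simp add: mult.commute)
  show add: "cinner (f + g) h = cinner f h + cinner g h" for f g h :: hardy
    using sums_unique2[OF cinner_hardy_sums[of "f + g" h]]
      sums_add[OF cinner_hardy_sums[of f h] cinner_hardy_sums[of g h]]
    by (simp add: algebra_simps)
  show scale: "cinner (c *\<^sub>C f) g = c * cinner f g" for c and f g :: hardy
    using sums_unique2[OF cinner_hardy_sums[of "c *\<^sub>C f" g]] sums_mult[OF cinner_hardy_sums[of f g], of c]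
    by (simp add: mult.assoc)
  show "inner f g = inner g f"
    unfolding inner_hardy_def by (subst comm) simp
  show "inner (f + g) h = inner f h + inner g h" "inner (r *\<^sub>R f) g = r * inner f g"
    unfolding inner_hardy_def by (simp_all add: add scaleR_hardy_def scale)
  show nonneg: "0 \<le> inner f f"
    using inner_hardy_sums[of f] by (rule sums_le[OF _ sums_zero, rotated]) simp
  show "inner f f = 0 \<longleftrightarrow> f = 0"
  proof
    assume "inner f f = 0"
    then have "(\<lambda>n. (cmod (hardy_coeff f n))\<^sup>2) sums 0" using inner_hardy_sums[of f] by simp
    then have "\<forall>n. (cmod (hardy_coeff f n))\<^sup>2 = 0"
      using suminf_eq_zero_iff[of "\<lambda>n. (cmod (hardy_coeff f n))\<^sup>2"] by (auto simp: sums_iff)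
    then show "f = 0" by (intro hardy_eqI) simp
  next
    assume "f = 0"
    then show "inner f f = 0" by (simp add: inner_hardy_def cinner_hardy_def)
  qed
qed (rule norm_hardy_def sgn_hardy_def dist_hardy_def uniformity_hardy_def open_hardy_def
      inner_hardy_def)+

end

lemma norm_hardy_sums: "(\<lambda>n. (cmod (hardy_coeff f n))\<^sup>2) sums (norm f)\<^sup>2"
  using inner_hardy_sums[of f] by (simp add: power2_norm_eq_inner)

lemma norm_hardy_coeff_le: "cmod (hardy_coeff f n) \<le> norm f"
proof -
  have "(\<Sum>k\<in>{n}. (cmod (hardy_coeff f k))\<^sup>2) \<le> (norm f)\<^sup>2"
    using norm_hardy_sums[of f] by (intro sum_le_suminf[THEN order_trans]) (auto simp: sums_iff)
  then show ?thesis by (simp add: power2_le_iff_abs_le)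
qed

lemma norm_hardy_leI:
  assumes "\<And>K. (\<Sum>n<K. (cmod (hardy_coeff f n))\<^sup>2) \<le> B\<^sup>2" "0 \<le> B"
  shows "norm f \<le> B"
proof -
  have "(norm f)\<^sup>2 \<le> B\<^sup>2"
    using norm_hardy_sums[of f] assms(1) by (metis suminf_le_const sums_iff)
  then show ?thesis using assms(2) by (rule power2_le_imp_le)
qed

instance hardy :: complex_hilbert_space
proof
  fix X :: "nat \<Rightarrow> hardy"
  assume X: "Cauchy X"
  have "Cauchy (\<lambda>m. hardy_coeff (X m) n)" for n
  proof (rule metric_CauchyI)
    fix e :: real assume "e > 0"
    then obtain M where M: "\<forall>m\<ge>M. \<forall>k\<ge>M. dist (X m) (X k) < e"
      using X by (metis Cauchy_def)
    have "dist (hardy_coeff (X m) n) (hardy_coeff (X k) n) \<le> dist (X m) (X k)" for m k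
      using norm_hardy_coeff_le[of "X m - X k" n] by (simp add: dist_norm)
    then show "\<exists>M. \<forall>m\<ge>M. \<forall>k\<ge>M. dist (hardy_coeff (X m) n) (hardy_coeff (X k) n) < e"
      using M by (meson le_less_trans)
  qed
  then have "\<exists>l. (\<lambda>m. hardy_coeff (X m) n) \<longlonglongrightarrow> l" for n
    using Cauchy_convergent convergent_def by blast
  then obtain a where a: "\<And>n. (\<lambda>m. hardy_coeff (X m) n) \<longlonglongrightarrow> a n"
    by metis
  have key: "\<exists>M. \<forall>m\<ge>M. \<forall>K. (\<Sum>n<K. (cmod (hardy_coeff (X m) n - a n))\<^sup>2) \<le> e\<^sup>2" if "e > 0" for e :: real
  proof -
    obtain M where M: "\<And>m k. m \<ge> M \<Longrightarrow> k \<ge> M \<Longrightarrow> dist (X m) (X k) < e"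
      using X \<open>e > 0\<close> by (metis Cauchy_def)
    have "(\<Sum>n<K. (cmod (hardy_coeff (X m) n - a n))\<^sup>2) \<le> e\<^sup>2" if m: "m \<ge> M" for m K
    proof (rule tendsto_upperbound)
      show "(\<lambda>k. \<Sum>n<K. (cmod (hardy_coeff (X m) n - hardy_coeff (X k) n))\<^sup>2)
          \<longlonglongrightarrow> (\<Sum>n<K. (cmod (hardy_coeff (X m) n - a n))\<^sup>2)"
        by (intro tendsto_intros a)
      show "\<forall>\<^sub>F k in sequentially. (\<Sum>n<K. (cmod (hardy_coeff (X m) n - hardy_coeff (X k) n))\<^sup>2) \<le> e\<^sup>2"
        using eventually_ge_at_top[of M]
      proof eventually_elim
        case (elim k)
        have "(\<Sum>n<K. (cmod (hardy_coeff (X m - X k) n))\<^sup>2) \<le> (norm (X m - X k))\<^sup>2"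
          using norm_hardy_sums[of "X m - X k"]
          by (intro sum_le_suminf[THEN order_trans]) (auto simp: sums_iff)
        also have "\<dots> \<le> e\<^sup>2"
          using M[OF m elim] by (intro power_mono) (auto simp: dist_norm)
        finally show ?case by simp
      qed
    qed simp
    then show ?thesis by blast
  qed
  obtain M where M: "\<And>K. (\<Sum>n<K. (cmod (hardy_coeff (X M) n - a n))\<^sup>2) \<le> 1\<^sup>2"
    using key[of 1] by auto
  have "square_summable (\<lambda>n. hardy_coeff (X M) n - a n)"
    unfolding square_summable_def by (rule summableI_nonneg_bounded[OF _ M]) simp
  from square_summable_add[OF square_summable_scale[OF this, of "-1"] square_summable_coeff[of "X M"]]
  have sq: "square_summable a" by simp
  have "X \<longlonglongrightarrow> hardy_of_coeffs a"
  proof (rule metric_LIMSEQ_I)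
    fix e :: real assume "e > 0"
    then obtain M where M: "\<And>m K. m \<ge> M \<Longrightarrow> (\<Sum>n<K. (cmod (hardy_coeff (X m) n - a n))\<^sup>2) \<le> (e / 2)\<^sup>2"
      using key[of "e / 2"] by auto
    have "norm (X m - hardy_of_coeffs a) \<le> e / 2" if "m \<ge> M" for m
      using M[OF that] \<open>e > 0\<close>
      by (intro norm_hardy_leI) (simp_all add: hardy_coeff_of_coeffs[OF sq])
    then show "\<exists>M. \<forall>m\<ge>M. dist (X m) (hardy_of_coeffs a) < e"
      using \<open>e > 0\<close> by (intro exI[of _ M]) (force simp: dist_norm)
  qed
  then show "convergent X" by (auto simp: convergent_def)
qed


section \<open>The weighted shift and its direct sum with the identity\<close>

definition hardy_basis :: "nat \<Rightarrow> hardy" where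
  "hardy_basis n = hardy_of_coeffs (\<lambda>k. if k = n then 1 else 0)"

lemma hardy_coeff_basis [simp]: "hardy_coeff (hardy_basis n) k = (if k = n then 1 else 0)"
proof -
  have "square_summable (\<lambda>k. if k = n then 1 else 0)"
    unfolding square_summable_def by (rule summable_finite[of "{n}"]) auto
  then show ?thesis by (simp add: hardy_basis_def hardy_coeff_of_coeffs)
qed

lemma hardy_fun_basis:
  assumes "z \<in> ball 0 1"
  shows "hardy_fun (hardy_basis n) z = z ^ n"
proof -
  have "(\<lambda>k. if k = n then z ^ k else 0) sums hardy_fun (hardy_basis n) z"
    using hardy_coeff_sums[OF assms, of "hardy_basis n"]
    by (rule back_subst[where P = "\<lambda>g. g sums _"]) auto
  then show ?thesis by (rule sums_unique2) (rule sums_single)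
qed

lemma bounded_linear_hardy_coeff: "bounded_linear (\<lambda>f. hardy_coeff f n)"
  by (rule bounded_linear_intro[where K = 1])
    (simp_all add: norm_hardy_coeff_le scaleR_conv_of_real)

lemma hardy_coeff_sum: "hardy_coeff (\<Sum>i\<in>A. f i) n = (\<Sum>i\<in>A. hardy_coeff (f i) n)"
  using bounded_linear.linear[OF bounded_linear_hardy_coeff] by (rule linear_sum)

lemma hardy_basis_sums: "(\<lambda>n. hardy_coeff f n *\<^sub>C hardy_basis n) sums f"
  unfolding sums_def
proof (rule metric_LIMSEQ_I)
  fix e :: real assume e: "e > 0"
  let ?t = "\<lambda>N. \<Sum>n<N. (cmod (hardy_coeff f n))\<^sup>2"
  let ?P = "\<lambda>N. \<Sum>n<N. hardy_coeff f n *\<^sub>C hardy_basis n"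
  have "?t \<longlonglongrightarrow> (norm f)\<^sup>2"
    using norm_hardy_sums[of f] by (simp add: sums_def)
  moreover have "(norm f)\<^sup>2 - (e / 2)\<^sup>2 < (norm f)\<^sup>2" using e by simp
  ultimately have "\<forall>\<^sub>F N in sequentially. (norm f)\<^sup>2 - (e / 2)\<^sup>2 < ?t N"
    by (rule order_tendstoD)
  then obtain N0 where N0: "\<And>N. N \<ge> N0 \<Longrightarrow> (norm f)\<^sup>2 - (e / 2)\<^sup>2 < ?t N"
    by (auto simp: eventually_sequentially)
  have "norm (f - ?P N) \<le> e / 2" if N: "N \<ge> N0" for N
  proof (rule norm_hardy_leI)
    fix K
    have c: "hardy_coeff (f - ?P N) n = (if n < N then 0 else hardy_coeff f n)" for n
      by (simp add: hardy_coeff_sum if_distrib cong: if_cong)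
    have "(\<Sum>n<K. (cmod (hardy_coeff (f - ?P N) n))\<^sup>2) + ?t N
        \<le> (\<Sum>n<max K N. (cmod (hardy_coeff f n))\<^sup>2)"
    proof -
      have "(\<Sum>n<K. (cmod (hardy_coeff (f - ?P N) n))\<^sup>2) = (\<Sum>n\<in>{N..<K}. (cmod (hardy_coeff f n))\<^sup>2)"
        unfolding c by (rule sum.mono_neutral_cong_right) auto
      also have "\<dots> + ?t N = (\<Sum>n\<in>{N..<K} \<union> {..<N}. (cmod (hardy_coeff f n))\<^sup>2)"
        by (rule sum.union_disjoint[symmetric]) auto
      also have "\<dots> \<le> (\<Sum>n<max K N. (cmod (hardy_coeff f n))\<^sup>2)"
        by (rule sum_mono2) auto
      finally show ?thesis by simp
    qed
    also have "\<dots> \<le> (norm f)\<^sup>2"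
      using norm_hardy_sums[of f] by (intro sum_le_suminf[THEN order_trans]) (auto simp: sums_iff)
    finally show "(\<Sum>n<K. (cmod (hardy_coeff (f - ?P N) n))\<^sup>2) \<le> (e / 2)\<^sup>2"
      using N0[OF N] by linarith
  qed (use e in simp)
  then show "\<exists>N0. \<forall>N\<ge>N0. dist (?P N) f < e"
    using e by (intro exI[of _ N0]) (force simp: dist_norm norm_minus_commute)
qed

lemma cinner_hardy_basis: "cinner (hardy_basis m) (hardy_basis n) = (if m = n then 1 else 0)"
proof -
  have "(\<lambda>k. if k = m then (if k = n then 1 else 0) else 0) sums cinner (hardy_basis m) (hardy_basis n)"
    using cinner_hardy_sums[of "hardy_basis m" "hardy_basis n"]
    by (rule back_subst[where P = "\<lambda>g. g sums _"]) auto
  moreover have "(\<lambda>k. if k = m then (if k = n then 1 else 0) else 0) sums (if m = n then 1 else 0 :: complex)"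
    by (rule sums_single)
  ultimately show ?thesis by (rule sums_unique2)
qed

definition hardy0 :: "hardy set" where
  "hardy0 = closure (cspan (hardy_basis ` {1..}))"

lemma hardy0_iff: "f \<in> hardy0 \<longleftrightarrow> hardy_coeff f 0 = 0"
proof
  have "cspan (hardy_basis ` {1..}) \<subseteq> {f. hardy_coeff f 0 = 0}"
    by (rule complex_vector.span_minimal) (auto simp: complex_vector.subspace_def)
  moreover have "closed {f. hardy_coeff f 0 = 0}"
    by (intro closed_Collect_eq continuous_on_const
        linear_continuous_on[OF bounded_linear_hardy_coeff])
  ultimately have "hardy0 \<subseteq> {f. hardy_coeff f 0 = 0}"
    unfolding hardy0_def by (rule closure_minimal)
  then show "f \<in> hardy0 \<Longrightarrow> hardy_coeff f 0 = 0" by blast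
next
  assume f: "hardy_coeff f 0 = 0"
  have "(\<Sum>n<N. hardy_coeff f n *\<^sub>C hardy_basis n) \<in> cspan (hardy_basis ` {1..})" for N
  proof (rule complex_vector.span_sum)
    fix n
    show "hardy_coeff f n *\<^sub>C hardy_basis n \<in> cspan (hardy_basis ` {1..})"
    proof (cases "n = 0")
      case True
      then show ?thesis by (simp add: f complex_vector.span_zero)
    next
      case False
      then have "hardy_basis n \<in> hardy_basis ` {1..}" by simp
      then show ?thesis by (intro complex_vector.span_scale complex_vector.span_base)
    qed
  qed
  then show "f \<in> hardy0"
    using hardy_basis_sums[of f] unfolding hardy0_def closure_sequential sums_def
    by (intro exI[of _ "\<lambda>N. \<Sum>n<N. hardy_coeff f n *\<^sub>C hardy_basis n"]) simp
qed

text \<open>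
  In terms of power series, \<open>S\<^sub>\<alpha>\<close> sends \<open>\<Sum>n\<ge>1. a\<^sub>n z\<^sup>n\<close> to \<open>\<Sum>n\<ge>1. \<alpha>\<^sub>n a\<^sub>n z\<^sup>n\<^sup>+\<^sup>1\<close>. Only its values on
  \<open>hardy0\<close> matter; lemma \<open>weighted_shift_unique\<close> below says that there it is the only bounded
  operator with \<open>S\<^sub>\<alpha> e\<^sub>n = \<alpha>\<^sub>n e\<^bsub>n+1\<^esub>\<close> for all \<open>n \<ge> 1\<close>. The value \<open>\<alpha> 0\<close> is never used.
\<close>

definition weighted_shift :: "(nat \<Rightarrow> complex) \<Rightarrow> hardy \<Rightarrow> hardy" where
  "weighted_shift \<alpha> f =
     hardy_of_coeffs (\<lambda>n. if n \<le> 1 then 0 else \<alpha> (n - 1) * hardy_coeff f (n - 1))"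

lemma hardy_coeff_weighted_shift:
  assumes "bounded (\<alpha> ` {1..})"
  shows "hardy_coeff (weighted_shift \<alpha> f) n =
    (if n \<le> 1 then 0 else \<alpha> (n - 1) * hardy_coeff f (n - 1))"
proof -
  obtain B where B: "\<And>n. n \<ge> 1 \<Longrightarrow> cmod (\<alpha> n) \<le> B"
    using assms by (auto simp: bounded_iff)
  have "B \<ge> 0" using B[of 1] norm_ge_zero[of "\<alpha> 1"] by linarith
  have "square_summable (\<lambda>n. (if n = 0 then 0 else \<alpha> n) * hardy_coeff f n)"
    by (rule square_summable_mult[where B = B]) (use B \<open>B \<ge> 0\<close> in \<open>auto simp: square_summable_coeff\<close>)
  then have "summable (\<lambda>n. (cmod (if Suc n \<le> 1 then 0 else \<alpha> n * hardy_coeff f n))\<^sup>2)"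
    unfolding square_summable_def by (rule back_subst[where P = summable]) (rule ext, simp)
  then have "square_summable (\<lambda>n. if n \<le> 1 then 0 else \<alpha> (n - 1) * hardy_coeff f (n - 1))"
    unfolding square_summable_def by (subst summable_Suc_iff[symmetric]) (simp only: diff_Suc_1)
  then show ?thesis by (simp add: weighted_shift_def hardy_coeff_of_coeffs)
qed

lemma weighted_shift_hardy0:
  assumes "bounded (\<alpha> ` {1..})"
  shows "weighted_shift \<alpha> f \<in> hardy0"
  by (simp add: hardy0_iff hardy_coeff_weighted_shift[OF assms])

lemma weighted_shift_basis:
  assumes "bounded (\<alpha> ` {1..})" "n \<ge> 1"
  shows "weighted_shift \<alpha> (hardy_basis n) = \<alpha> n *\<^sub>C hardy_basis (Suc n)"
  by (rule hardy_eqI) (use assms(2) in \<open>auto simp: hardy_coeff_weighted_shift[OF assms(1)]\<close>)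

lemma bounded_clinear_weighted_shift:
  assumes "bounded (\<alpha> ` {1..})"
  shows "bounded_clinear (weighted_shift \<alpha>)"
proof -
  note c = hardy_coeff_weighted_shift[OF assms]
  obtain B where B: "\<And>n. n \<ge> 1 \<Longrightarrow> cmod (\<alpha> n) \<le> B"
    using assms by (auto simp: bounded_iff)
  have "B \<ge> 0" using B[of 1] norm_ge_zero[of "\<alpha> 1"] by linarith
  have bnd: "norm (weighted_shift \<alpha> f) \<le> norm f * B" for f
  proof (rule norm_hardy_leI)
    fix K
    have "(\<Sum>n<K. (cmod (hardy_coeff (weighted_shift \<alpha> f) n))\<^sup>2)
        \<le> (\<Sum>n<Suc K. (cmod (hardy_coeff (weighted_shift \<alpha> f) n))\<^sup>2)"
      by simp
    also have "\<dots> = (\<Sum>n<K. (cmod (hardy_coeff (weighted_shift \<alpha> f) (Suc n)))\<^sup>2)"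
      by (subst sum.lessThan_Suc_shift) (simp add: c)
    also have "\<dots> \<le> (\<Sum>n<K. B\<^sup>2 * (cmod (hardy_coeff f n))\<^sup>2)"
    proof (rule sum_mono)
      fix n
      show "(cmod (hardy_coeff (weighted_shift \<alpha> f) (Suc n)))\<^sup>2 \<le> B\<^sup>2 * (cmod (hardy_coeff f n))\<^sup>2"
        using B[of n] by (auto simp: c norm_mult power_mult_distrib intro!: mult_right_mono power_mono)
    qed
    also have "\<dots> = B\<^sup>2 * (\<Sum>n<K. (cmod (hardy_coeff f n))\<^sup>2)"
      by (simp add: sum_distrib_left)
    also have "\<dots> \<le> B\<^sup>2 * (norm f)\<^sup>2"
      using norm_hardy_sums[of f]
      by (intro mult_left_mono sum_le_suminf[THEN order_trans]) (auto simp: sums_iff)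
    finally show "(\<Sum>n<K. (cmod (hardy_coeff (weighted_shift \<alpha> f) n))\<^sup>2) \<le> (norm f * B)\<^sup>2"
      by (simp add: power_mult_distrib mult.commute)
  qed (use \<open>B \<ge> 0\<close> in simp)
  have "bounded_linear (weighted_shift \<alpha>)"
  proof (rule bounded_linear_intro[OF _ _ bnd])
    show "weighted_shift \<alpha> (f + g) = weighted_shift \<alpha> f + weighted_shift \<alpha> g" for f g
      by (rule hardy_eqI) (simp add: c algebra_simps)
    show "weighted_shift \<alpha> (r *\<^sub>R f) = r *\<^sub>R weighted_shift \<alpha> f" for r f
      by (rule hardy_eqI) (simp add: c algebra_simps)
  qed
  moreover have "weighted_shift \<alpha> (z *\<^sub>C f) = z *\<^sub>C weighted_shift \<alpha> f" for z f
    by (rule hardy_eqI) (simp add: c algebra_simps)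
  ultimately show ?thesis by (simp add: bounded_clinear_def)
qed

lemma weighted_shift_unique:
  fixes S :: "hardy \<Rightarrow> hardy"
  assumes \<alpha>: "bounded (\<alpha> ` {1..})"
    and add: "\<And>f g. f \<in> hardy0 \<Longrightarrow> g \<in> hardy0 \<Longrightarrow> S (f + g) = S f + S g"
    and scale: "\<And>c f. f \<in> hardy0 \<Longrightarrow> S (c *\<^sub>C f) = c *\<^sub>C S f"
    and bdd: "\<And>f. f \<in> hardy0 \<Longrightarrow> norm (S f) \<le> B * norm f"
    and basis: "\<And>n. n \<ge> 1 \<Longrightarrow> S (hardy_basis n) = \<alpha> n *\<^sub>C hardy_basis (Suc n)"
    and f: "f \<in> hardy0"
  shows "S f = weighted_shift \<alpha> f"
proof -
  define W where "W = weighted_shift \<alpha>"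
  have W: "bounded_linear W" "\<And>c f. W (c *\<^sub>C f) = c *\<^sub>C W f"
    using bounded_clinear_weighted_shift[OF \<alpha>] by (auto simp: W_def bounded_clinear_def)
  obtain C where C: "\<And>f. norm (W f) \<le> norm f * C"
    using bounded_linear.bounded[OF W(1)] by blast
  define P where "P N = (\<Sum>n<N. hardy_coeff f n *\<^sub>C hardy_basis n)" for N
  have f0: "hardy_coeff f 0 = 0" using f by (simp add: hardy0_iff)
  have S0: "S 0 = 0" using scale[OF f, of 0] by (simp add: complex_vector.scale_zero_left)
  have P0: "P N \<in> hardy0" for N
    by (simp add: hardy0_iff P_def hardy_coeff_sum f0 if_distrib cong: if_cong)
  have eq: "S (P N) = W (P N)" for N
  proof (induction N)
    case 0
    show ?case by (simp add: P_def S0 linear_0[OF bounded_linear.linear[OF W(1)]])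
  next
    case (Suc N)
    have N: "hardy_coeff f N *\<^sub>C hardy_basis N \<in> hardy0"
      by (cases N) (simp_all add: hardy0_iff f0)
    have "S (hardy_coeff f N *\<^sub>C hardy_basis N) = W (hardy_coeff f N *\<^sub>C hardy_basis N)"
    proof (cases "N = 0")
      case True
      then show ?thesis
        by (simp add: f0 S0 linear_0[OF bounded_linear.linear[OF W(1)]])
    next
      case False
      then have "hardy_basis N \<in> hardy0" by (simp add: hardy0_iff)
      with False show ?thesis
        by (simp add: scale W(2) basis) (simp add: W_def weighted_shift_basis[OF \<alpha>])
    qed
    with Suc show ?case
      using add[OF P0 N] bounded_linear.linear[OF W(1), THEN linear_add]
      by (simp add: P_def)
  qed
  have "norm (S f - W f) \<le> (B + C) * norm (f - P N)" for N
  proof -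
    have d: "f - P N \<in> hardy0" using f P0[of N] by (simp add: hardy0_iff)
    have "S f = S (f - P N) + S (P N)" using add[OF d P0[of N]] by simp
    moreover have "W f = W (f - P N) + W (P N)"
      using bounded_linear.linear[OF W(1), THEN linear_diff, of f "P N"] by simp
    ultimately have "norm (S f - W f) = norm (S (f - P N) - W (f - P N))"
      by (simp add: eq)
    also have "\<dots> \<le> norm (S (f - P N)) + norm (W (f - P N))" by (rule norm_triangle_ineq4)
    also have "\<dots> \<le> (B + C) * norm (f - P N)"
      using bdd[OF d] C[of "f - P N"] by (simp add: algebra_simps)
    finally show ?thesis .
  qed
  moreover have "(\<lambda>N. (B + C) * norm (f - P N)) \<longlonglongrightarrow> (B + C) * norm (f - f)"
    unfolding P_def using hardy_basis_sums[of f] by (intro tendsto_intros) (simp add: sums_def)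
  ultimately have "norm (S f - W f) \<le> (B + C) * norm (f - f)"
    by (intro tendsto_lowerbound) auto
  then show ?thesis by (simp add: W_def)
qed

text \<open>
  \<open>I \<oplus> S\<close> on \<open>\<complex>e\<^sub>0 \<oplus> hardy0\<close>: the component of \<open>f\<close> in \<open>\<complex>e\<^sub>0\<close> is \<open>hardy_coeff f 0 *\<^sub>C e\<^sub>0\<close>; see
  \<open>id_oplus_direct_sum\<close> below.
\<close>

definition id_oplus :: "(hardy \<Rightarrow> hardy) \<Rightarrow> hardy \<Rightarrow> hardy" where
  "id_oplus S f =
     hardy_coeff f 0 *\<^sub>C hardy_basis 0 + S (f - hardy_coeff f 0 *\<^sub>C hardy_basis 0)"

lemma id_oplus_direct_sum:
  assumes "x \<in> hardy0"
  shows "id_oplus S (\<gamma> *\<^sub>C hardy_basis 0 + x) = \<gamma> *\<^sub>C hardy_basis 0 + S x"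
  using assms by (simp add: id_oplus_def hardy0_iff)

lemma hardy_direct_sum: "\<exists>!(\<gamma>, x). x \<in> hardy0 \<and> f = \<gamma> *\<^sub>C hardy_basis 0 + x"
proof (rule ex1I[of _ "(hardy_coeff f 0, f - hardy_coeff f 0 *\<^sub>C hardy_basis 0)"])
  fix p
  assume "case p of (\<gamma>, x) \<Rightarrow> x \<in> hardy0 \<and> f = \<gamma> *\<^sub>C hardy_basis 0 + x"
  then show "p = (hardy_coeff f 0, f - hardy_coeff f 0 *\<^sub>C hardy_basis 0)"
    by (auto simp: hardy0_iff split: prod.splits)
qed (simp add: hardy0_iff)

definition weight_prod :: "(nat \<Rightarrow> complex) \<Rightarrow> nat \<Rightarrow> complex" where
  "weight_prod \<alpha> j = (\<Prod>i=1..j. \<alpha> i)"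

end

theory Submission
  imports Defs
begin

text \<open>
  The vector \<open>x = e\<^sub>0 + e\<^sub>1\<close> is cyclic for \<open>T = I \<oplus> S\<^sub>\<alpha>\<close>. Its orbit is \<open>T\<^sup>n x = e\<^sub>0 + \<omega>\<^sub>n e\<^bsub>n+1\<^esub>\<close>, with
  \<open>\<omega>\<^sub>0 = 1\<close>. All these vectors share the component \<open>e\<^sub>0\<close>, while their other components are mutually
  orthogonal; an average \<open>\<Sum>\<^sub>j t\<^sub>j T\<^sup>j x\<close> with \<open>\<Sum>\<^sub>j t\<^sub>j = 1\<close> is therefore at squared distance
  \<open>\<Sum>\<^sub>j |t\<^sub>j|\<^sup>2 |\<omega>\<^sub>j|\<^sup>2\<close> from \<open>e\<^sub>0\<close>. By the Cauchy-Schwarz inequality the least value of this, over averages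
  supported in a finite set \<open>F\<close>, is the inverse of \<open>\<Sum>\<^bsub>j\<in>F\<^esub> |\<omega>\<^sub>j|\<^sup>-\<^sup>2\<close>, attained when \<open>t\<^sub>j\<close> is proportional
  to \<open>|\<omega>\<^sub>j|\<^sup>-\<^sup>2\<close> (lemma \<open>weighted_average_dist\<close>). As \<open>\<Sum>\<^sub>j |\<omega>\<^sub>j|\<^sup>-\<^sup>2\<close> diverges, \<open>e\<^sub>0\<close> lies in the closed span
  of the orbit. Subtracting \<open>e\<^sub>0\<close> from \<open>T\<^sup>n x\<close> and dividing by \<open>\<omega>\<^sub>n\<close>, which is non-zero, puts every
  \<open>e\<^bsub>n+1\<^esub>\<close> there too, and the closed span of the basis is the whole space.
\<close>

lemma norm_scaleC: "norm (c *\<^sub>C x) = cmod c * norm (x :: 'a::complex_inner)"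
proof -
  have right: "cinner x (c *\<^sub>C x) = cnj c * cinner x x"
    by (metis cinner_commute cinner_scaleC_left complex_cnj_mult)
  have "inner (c *\<^sub>C x) (c *\<^sub>C x) = Re (complex_of_real ((cmod c)\<^sup>2) * cinner x x)"
    unfolding inner_eq_Re_cinner cinner_scaleC_left right complex_norm_square
    by (simp only: mult.assoc)
  also have "\<dots> = (cmod c)\<^sup>2 * inner x x"
    by (simp add: inner_eq_Re_cinner del: of_real_power)
  finally show ?thesis
    by (simp add: norm_eq_sqrt_inner real_sqrt_mult)
qed

lemma bounded_linear_scaleC_right: "bounded_linear (\<lambda>x::'a::complex_inner. c *\<^sub>C x)"
  by (rule bounded_linear_intro[where K = "cmod c"])
    (simp_all add: scaleC_add_right scaleR_scaleC scaleC_scaleC norm_scaleC mult.commute)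

lemma bounded_linear_scaleC_left: "bounded_linear (\<lambda>c. c *\<^sub>C (x::'a::complex_inner))"
  by (rule bounded_linear_intro[where K = "norm x"])
    (simp_all add: scaleC_add_left scaleR_scaleC scaleC_scaleC norm_scaleC scaleR_conv_of_real)

lemma closure_complex_subspace:
  fixes V :: "'a::complex_inner set"
  assumes "complex_vector.subspace V"
  shows "complex_vector.subspace (closure V)"
  unfolding complex_vector.subspace_def
proof (intro conjI ballI allI)
  show "0 \<in> closure V"
    using complex_vector.subspace_0[OF assms] closure_subset by blast
next
  fix x y assume "x \<in> closure V" "y \<in> closure V"
  then obtain X Y where "\<And>n. X n \<in> V" "X \<longlonglongrightarrow> x" "\<And>n. Y n \<in> V" "Y \<longlonglongrightarrow> y"
    unfolding closure_sequential by blast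
  then show "x + y \<in> closure V"
    unfolding closure_sequential
    by (intro exI[of _ "\<lambda>n. X n + Y n"]) (auto intro: tendsto_add complex_vector.subspace_add[OF assms])
next
  fix c x assume "x \<in> closure V"
  then obtain X where "\<And>n. X n \<in> V" "X \<longlonglongrightarrow> x"
    unfolding closure_sequential by blast
  then show "c *\<^sub>C x \<in> closure V"
    unfolding closure_sequential
    by (intro exI[of _ "\<lambda>n. c *\<^sub>C X n"])
      (auto intro: bounded_linear.tendsto[OF bounded_linear_scaleC_right]
        complex_vector.subspace_scale[OF assms])
qed

lemma closed_subspace_eq_UNIV_if_basis:
  assumes V: "complex_vector.subspace V" "closed V" and basis: "\<And>n. hardy_basis n \<in> V"
  shows "V = UNIV"
proof -
  have "f \<in> V" for f
  proof (rule closed_sequentially[OF V(2)])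
    show "(\<Sum>n<N. hardy_coeff f n *\<^sub>C hardy_basis n) \<in> V" for N
      by (intro complex_vector.subspace_sum[OF V(1)] complex_vector.subspace_scale[OF V(1)] basis)
    show "(\<lambda>N. \<Sum>n<N. hardy_coeff f n *\<^sub>C hardy_basis n) \<longlonglongrightarrow> f"
      using hardy_basis_sums by (simp only: sums_def)
  qed
  then show ?thesis by blast
qed

lemma bounded_clinear_id_oplus:
  assumes "bounded_clinear S"
  shows "bounded_clinear (id_oplus S)"
proof -
  have S: "bounded_linear S" "\<And>c f. S (c *\<^sub>C f) = c *\<^sub>C S f"
    using assms by (auto simp: bounded_clinear_def)
  have P: "bounded_linear (\<lambda>f. hardy_coeff f 0 *\<^sub>C hardy_basis 0)"
    by (rule bounded_linear_compose[OF bounded_linear_scaleC_left bounded_linear_hardy_coeff])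
  have "bounded_linear (\<lambda>f. hardy_coeff f 0 *\<^sub>C hardy_basis 0 +
      S (f - hardy_coeff f 0 *\<^sub>C hardy_basis 0))"
    by (intro bounded_linear_add P bounded_linear_compose[OF S(1)] bounded_linear_sub
        bounded_linear_ident)
  then have "bounded_linear (id_oplus S)"
    unfolding id_oplus_def[abs_def] .
  moreover have "id_oplus S (c *\<^sub>C f) = c *\<^sub>C id_oplus S f" for c f
    by (simp add: id_oplus_def scaleC_add_right S(2)[symmetric] scaleC_scaleC
        complex_vector.scale_right_diff_distrib)
  ultimately show ?thesis by (simp add: bounded_clinear_def)
qed

lemma weighted_shift_orbit:
  assumes \<alpha>: "bounded (\<alpha> ` {1..})"
  shows "(id_oplus (weighted_shift \<alpha>) ^^ n) (hardy_basis 0 + hardy_basis 1) =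
    hardy_basis 0 + weight_prod \<alpha> n *\<^sub>C hardy_basis (Suc n)"
proof (induction n)
  case 0
  show ?case by (simp add: weight_prod_def scaleC_one)
next
  case (Suc n)
  let ?e = "hardy_basis 0" and ?y = "weight_prod \<alpha> n *\<^sub>C hardy_basis (Suc n)"
  have "id_oplus (weighted_shift \<alpha>) (?e + ?y) = ?e + weighted_shift \<alpha> ?y"
    using id_oplus_direct_sum[of ?y "weighted_shift \<alpha>" 1] by (simp add: hardy0_iff scaleC_one)
  also have "weighted_shift \<alpha> ?y = weight_prod \<alpha> (Suc n) *\<^sub>C hardy_basis (Suc (Suc n))"
    using bounded_clinear_weighted_shift[OF \<alpha>] weighted_shift_basis[OF \<alpha>, of "Suc n"]
    by (simp add: bounded_clinear_def scaleC_scaleC weight_prod_def)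
  finally show ?case using Suc by simp
qed

lemma norm_sum_hardy_basis:
  assumes "finite A"
  shows "(norm (\<Sum>n\<in>A. c n *\<^sub>C hardy_basis n))\<^sup>2 = (\<Sum>n\<in>A. (cmod (c n))\<^sup>2)"
proof -
  have "(cmod (hardy_coeff (\<Sum>n\<in>A. c n *\<^sub>C hardy_basis n) k))\<^sup>2 =
      (if k \<in> A then (cmod (c k))\<^sup>2 else 0)" for k
    using assms by (simp add: hardy_coeff_sum if_distrib cong: if_cong)
  then show ?thesis
    using norm_hardy_sums[of "\<Sum>n\<in>A. c n *\<^sub>C hardy_basis n"]
      sums_If_finite_set[OF assms, of "\<lambda>n. (cmod (c n))\<^sup>2"] sums_unique2 by simp
qed

text \<open>
  The weights \<open>|w\<^sub>j|\<^sup>-\<^sup>2 / \<Sum>\<^sub>i |w\<^sub>i|\<^sup>-\<^sup>2\<close> are those that bring the average closest to \<open>e\<^sub>0\<close>: they are the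
  case of equality in \<open>1 = |\<Sum>\<^sub>j t\<^sub>j|\<^sup>2 \<le> (\<Sum>\<^sub>j |t\<^sub>j w\<^sub>j|\<^sup>2) (\<Sum>\<^sub>j |w\<^sub>j|\<^sup>-\<^sup>2)\<close>.
\<close>

lemma weighted_average_dist:
  fixes w :: "nat \<Rightarrow> complex" and F :: "nat set"
  defines "W \<equiv> \<Sum>j\<in>F. (inverse (cmod (w j)))\<^sup>2"
  assumes F: "finite F" and w: "\<And>j. j \<in> F \<Longrightarrow> w j \<noteq> 0" and W: "W > 0"
  shows "(dist (\<Sum>j\<in>F. complex_of_real ((inverse (cmod (w j)))\<^sup>2 / W) *\<^sub>C
           (hardy_basis 0 + w j *\<^sub>C hardy_basis (Suc j))) (hardy_basis 0))\<^sup>2 = inverse W"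
proof -
  define t where "t j = complex_of_real ((inverse (cmod (w j)))\<^sup>2 / W)" for j
  have "(\<Sum>j\<in>F. t j) = complex_of_real ((\<Sum>j\<in>F. (inverse (cmod (w j)))\<^sup>2) / W)"
    by (simp only: t_def of_real_sum sum_divide_distrib)
  also have "\<dots> = 1"
    using W by (simp only: W_def[symmetric]) simp
  finally have t1: "(\<Sum>j\<in>F. t j) = 1" .
  have "(\<Sum>j\<in>F. t j *\<^sub>C (hardy_basis 0 + w j *\<^sub>C hardy_basis (Suc j))) =
      (\<Sum>j\<in>F. t j) *\<^sub>C hardy_basis 0 + (\<Sum>j\<in>F. (t j * w j) *\<^sub>C hardy_basis (Suc j))"
    by (simp add: scaleC_add_right scaleC_scaleC sum.distrib complex_vector.scale_sum_left)
  then have "(\<Sum>j\<in>F. t j *\<^sub>C (hardy_basis 0 + w j *\<^sub>C hardy_basis (Suc j))) - hardy_basis 0 =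
      (\<Sum>j\<in>F. (t j * w j) *\<^sub>C hardy_basis (Suc j))"
    by (simp add: t1 scaleC_one)
  also have "\<dots> = (\<Sum>n\<in>Suc ` F. (t (n - 1) * w (n - 1)) *\<^sub>C hardy_basis n)"
    by (simp add: sum.reindex)
  finally have "(dist (\<Sum>j\<in>F. t j *\<^sub>C (hardy_basis 0 + w j *\<^sub>C hardy_basis (Suc j))) (hardy_basis 0))\<^sup>2 =
      (\<Sum>n\<in>Suc ` F. (cmod (t (n - 1) * w (n - 1)))\<^sup>2)"
    unfolding dist_norm using F by (simp only: norm_sum_hardy_basis finite_imageI)
  also have "\<dots> = (\<Sum>j\<in>F. (cmod (t j * w j))\<^sup>2)"
    by (simp add: sum.reindex)
  also have "\<dots> = (\<Sum>j\<in>F. (inverse (cmod (w j)))\<^sup>2 / W\<^sup>2)"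
    using w W by (intro sum.cong refl)
      (simp add: t_def norm_mult norm_power norm_divide norm_inverse field_simps power2_eq_square)
  also have "\<dots> = W / W\<^sup>2"
    by (simp only: W_def sum_divide_distrib)
  also have "\<dots> = inverse W"
    using W by (simp add: field_simps power2_eq_square)
  finally show ?thesis by (simp only: t_def)
qed

lemma basis_zero_in_closed_span:
  fixes w :: "nat \<Rightarrow> complex"
  assumes w: "\<And>j. w j \<noteq> 0"
    and div: "\<not> (\<lambda>j. (inverse (cmod (w j)))\<^sup>2) summable_on A"
  shows "hardy_basis 0 \<in> closure (cspan (range (\<lambda>j. hardy_basis 0 + w j *\<^sub>C hardy_basis (Suc j))))"
  unfolding closure_approachable
proof (intro allI impI)
  fix e :: real assume e: "e > 0"
  let ?s = "sum (\<lambda>j. (inverse (cmod (w j)))\<^sup>2)"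
  have "\<not> bdd_above (?s ` {F. F \<subseteq> A \<and> finite F})"
    using div nonneg_bdd_above_summable_on[of A "\<lambda>j. (inverse (cmod (w j)))\<^sup>2"] by auto
  then obtain F where F: "finite F" "?s F > inverse (e\<^sup>2)"
    unfolding bdd_above_def by (auto simp: not_le)
  have W: "?s F > 0"
    using F(2) e by (meson less_trans positive_imp_inverse_positive zero_less_power)
  define v where "v = (\<Sum>j\<in>F. complex_of_real ((inverse (cmod (w j)))\<^sup>2 / ?s F) *\<^sub>C
           (hardy_basis 0 + w j *\<^sub>C hardy_basis (Suc j)))"
  have "v \<in> cspan (range (\<lambda>j. hardy_basis 0 + w j *\<^sub>C hardy_basis (Suc j)))"
    unfolding v_def
    by (intro complex_vector.span_sum complex_vector.span_scale complex_vector.span_base) simp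
  moreover have "(dist v (hardy_basis 0))\<^sup>2 = inverse (?s F)"
    unfolding v_def using F(1) w W by (rule weighted_average_dist)
  then have "(dist v (hardy_basis 0))\<^sup>2 < e\<^sup>2"
    using less_imp_inverse_less[OF F(2)] e by simp
  then have "dist v (hardy_basis 0) < e"
    using e by (intro power2_less_imp_less[of _ e]) auto
  ultimately show "\<exists>y\<in>cspan (range (\<lambda>j. hardy_basis 0 + w j *\<^sub>C hardy_basis (Suc j))).
      dist y (hardy_basis 0) < e"
    by blast
qed

theorem theorem5p15:
  fixes \<alpha> :: "nat \<Rightarrow> complex"
  assumes "bounded (\<alpha> ` {1..})"
    and "\<And>n. n \<ge> 1 \<Longrightarrow> \<alpha> n \<noteq> 0"
    and "\<not> (\<lambda>j. (inverse (cmod (weight_prod \<alpha> j)))\<^sup>2) summable_on {1..}"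
  shows "cyclic_operator (id_oplus (weighted_shift \<alpha>))"
proof -
  let ?T = "id_oplus (weighted_shift \<alpha>)" and ?x = "hardy_basis 0 + hardy_basis 1"
  have w: "weight_prod \<alpha> n \<noteq> 0" for n
    using assms(2) by (simp add: weight_prod_def)
  define V where "V = closure (cspan (range (\<lambda>n. (?T ^^ n) ?x)))"
  have V: "complex_vector.subspace V"
    unfolding V_def by (intro closure_complex_subspace complex_vector.subspace_span)
  have orbit: "hardy_basis 0 + weight_prod \<alpha> n *\<^sub>C hardy_basis (Suc n) \<in> V" for n
    unfolding V_def weighted_shift_orbit[OF assms(1)]
    by (intro closure_subset[THEN subsetD] complex_vector.span_base) simp
  have e0: "hardy_basis 0 \<in> V"
    unfolding V_def weighted_shift_orbit[OF assms(1)]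
    using w assms(3) by (rule basis_zero_in_closed_span)
  have "hardy_basis n \<in> V" for n
  proof (cases n)
    case (Suc m)
    have "inverse (weight_prod \<alpha> m) *\<^sub>C
        ((hardy_basis 0 + weight_prod \<alpha> m *\<^sub>C hardy_basis (Suc m)) - hardy_basis 0) \<in> V"
      by (intro complex_vector.subspace_scale[OF V] complex_vector.subspace_diff[OF V] orbit e0)
    then show ?thesis
      using w[of m] Suc by (simp add: scaleC_scaleC scaleC_one)
  qed (use e0 in simp)
  then have "V = UNIV"
    by (intro closed_subspace_eq_UNIV_if_basis V) (simp add: V_def)
  then show ?thesis
    unfolding cyclic_operator_def V_def
    using bounded_clinear_id_oplus[OF bounded_clinear_weighted_shift[OF assms(1)]] by blast
qed

end
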